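(* For any noncrossing partition $\pi$ and any integer $n\ge1$, $\phi_{\mathcal{NCP}}(\pi)(n)$ is the number of maps $f$ from the set of blocks of $\pi$ to $[n]=\{1,\ldots,n\}$ such that, for all blocks $b,b'$ of $\pi$: - if $b\le_\pi b'$ and $b\ne b'$, then $f(b)<f(b')$; - if $f(b)=f(b')$ and $\max(b)<\min(b')$, then there exists a block $b''$ of $\pi$ such that $]\max(b),\min(b')[\,\cap\, b''\ne\emptyset$ and $f(b'')<f(b)=f(b')$.
   Context: $\mathbb{K}$ is a field of characteristic zero. A noncrossing partition is a partition $\pi$ of a set $[n]=\{1,\ldots,n\}$, $n\ge1$, into nonempty blocks such that there are no distinct blocks $b\ne b'$ and $x,z\in b$, $y,t\in b'$ with $x<y<z<t$. $|\pi|$ is its number of blocks; $\mathcal{NCP}$ is the set of all noncrossing partitions. For a nonempty set $Y$ of blocks of $\pi$, $\pi_{\mid Y}$ is the noncrossing partition obtained by deleting the blocks not in $Y$ and renumbering the remaining elements increasingly; $\pi_{\mid\emptyset}=1$. The nesting order on blocks is $b\le_\pi b'\iff b'\subseteq[\min b,\max b]$. An ideal of $\pi$ is a set $J$ of blocks that is upward closed for $\le_\pi$; then the union of its blocks decomposes into maximal subsets of consecutive integers $I_1,\ldots,I_k$, each a union of blocks, and $\pi_{\mid_\cdot J}=\prod_i\pi_{\mid I_i}$ (restriction to the blocks contained in $I_i$; product $\cdot$ below). $\mathbb{K}[\mathcal{NCP}]$ is the free commutative algebra generated by $\mathcal{NCP}$, with product $\cdot$ and unit $1$. It carries two coproducts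 which are algebra morphisms, given on $\pi\in\mathcal{NCP}$ by $\Delta(\pi)=\sum_{J\text{ ideal of }\pi}\pi_{\mid\pi\setminus J}\otimes\pi_{\mid_\cdot J}$ and $\delta(\pi)=\sum_{\sim\in\mathcal{E}_c[\pi]}\pi/\!\sim\,\otimes\,\pi\mid_\cdot\sim$, where, for an equivalence $\sim$ on the set of blocks of $\pi$, $\pi/\!\sim$ is the partition whose blocks are the unions of the blocks in each class, $\mathcal{E}_c[\pi]$ is the set of $\sim$ for which $\pi/\!\sim$ is noncrossing, and $\pi\mid_\cdot\sim=\prod_{C\text{ class of }\sim}\pi_{\mid C}$. The counits are the algebra morphisms with $\varepsilon_\Delta(\pi)=0$, and $\epsilon_\delta(\pi)=1$ if $|\pi|=1$, $\epsilon_\delta(\pi)=0$ otherwise. $(\mathbb{K}[\mathcal{NCP}],\cdot,\Delta,\delta)$ is a double bialgebra: both $\Delta$ and $\delta$ give bialgebras, $(\Delta\otimes\mathrm{Id})\circ\delta=m_{1,3,24}\circ(\delta\otimes\delta)\circ\Delta$ with $m_{1,3,24}(a_1\otimes a_2\otimes a_3\otimes a_4)=a_1\otimes a_3\otimes a_2a_4$, and $(\varepsilon_\Delta\otimes\mathrm{Id})\circ\delta(x)=\varepsilon_\Delta(x)1$. Likewise $\mathbb{K}[X]$ is a double bialgebra with multiplicative coproducts $\Delta(X)=X\otimes1+1\otimes X$, $\delta(X)=X\otimes X$ and counits $P\mapsto P(0)$, $P\mapsto P(1)$. $\phi_{\mathcal{NCP}}:\mathbb{K}[\mathcal{NCP}]\to\mathbb{K}[X]$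 is the unique double bialgebra morphism (algebra morphism compatible with both coproducts and both counits). By known results it exists, is unique, and for $x\in\ker\varepsilon_\Delta$, $\phi_{\mathcal{NCP}}(x)=\sum_{k\ge1}\epsilon_\delta^{\otimes k}\circ\tilde\Delta^{(k-1)}(x)\,H_k(X)$, with $\tilde\Delta(x)=\Delta(x)-x\otimes1-1\otimes x$, $\tilde\Delta^{(k-1)}$ its iterates ($\tilde\Delta^{(0)}=\mathrm{Id}$), and $H_k(X)=X(X-1)\cdots(X-k+1)/k!$. *)

theory Defs
  imports
    "HOL-Library.Disjoint_Sets"
    "HOL-Library.FuncSet"
    "HOL-Library.Multiset"
    "HOL-Library.Poly_Mapping"
    "HOL-Library.Product_Plus"
    "HOL-Computational_Algebra.Polynomial"
begin

section \<open>Noncrossing partitions\<close>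

definition noncrossing :: "nat set set \<Rightarrow> bool" where
  "noncrossing P \<longleftrightarrow>
     \<not> (\<exists>b\<in>P. \<exists>b'\<in>P. b \<noteq> b' \<and>
          (\<exists>x\<in>b. \<exists>y\<in>b'. \<exists>z\<in>b. \<exists>t\<in>b'. x < y \<and> y < z \<and> z < t))"

text \<open>The size \<open>n\<close> is not recorded separately: it is determined by \<open>\<Union>P = {1..n}\<close>.\<close>

typedef ncp = "{P :: nat set set. \<exists>n\<ge>1. partition_on {1..n} P \<and> noncrossing P}"
  morphisms blocks Abs_ncp
proof -
  have "partition_on {1..1} {{1::nat}}" and "noncrossing {{1}}"
    by (auto simp: partition_on_def noncrossing_def)
  then show ?thesis by blast
qed

text \<open>\<open>nest b b'\<close> is the nesting order \<open>b \<le> b'\<close>; the larger block lies inside.\<close>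

definition nest :: "nat set \<Rightarrow> nat set \<Rightarrow> bool" where
  "nest b b' \<longleftrightarrow> b' \<subseteq> {Min b..Max b}"

definition rank :: "nat set \<Rightarrow> nat \<Rightarrow> nat" where
  "rank S x = card {y \<in> S. y \<le> x}"

definition renumber :: "nat set set \<Rightarrow> nat set set" where
  "renumber Y = (\<lambda>b. rank (\<Union>Y) ` b) ` Y"

definition ideals :: "ncp \<Rightarrow> nat set set set" where
  "ideals \<pi> = {J. J \<subseteq> blocks \<pi> \<and> (\<forall>b\<in>J. \<forall>b'\<in>blocks \<pi>. nest b b' \<longrightarrow> b' \<in> J)}"

definition components :: "nat set \<Rightarrow> nat set set" where
  "components S =
     {I. (\<exists>a b. a \<le> b \<and> I = {a..b}) \<and> I \<subseteq> S \<and>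
         (\<forall>a b. I \<subseteq> {a..b} \<and> {a..b} \<subseteq> S \<longrightarrow> {a..b} = I)}"

definition merge :: "nat set set \<Rightarrow> (nat set \<times> nat set) set \<Rightarrow> nat set set" where
  "merge P r = \<Union> ` (P // r)"

definition Ec :: "ncp \<Rightarrow> (nat set \<times> nat set) set set" where
  "Ec \<pi> = {r. equiv (blocks \<pi>) r \<and> noncrossing (merge (blocks \<pi>) r)}"

text \<open>The next facts show that \<^const>\<open>Abs_ncp\<close> is only applied below to noncrossing partitions.\<close>

lemma blocks_finite: "finite (\<Union>(blocks \<pi>))"
  using blocks[of \<pi>] by (auto simp: partition_on_def)

lemma renumber_ncp:
  assumes "Y \<subseteq> blocks \<pi>" "Y \<noteq> {}"
  shows "blocks (Abs_ncp (renumber Y)) = renumber Y"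
proof -
  define S where "S = \<Union>Y"
  have P: "disjoint (blocks \<pi>)" "{} \<notin> blocks \<pi>" and ncP: "noncrossing (blocks \<pi>)"
    using blocks[of \<pi>] by (auto simp: partition_on_def)
  have Y: "disjoint Y" "{} \<notin> Y"
    using P assms(1) by (auto simp: disjoint_def)
  have nc: "noncrossing Y"
    unfolding noncrossing_def
  proof (rule notI, elim bexE conjE)
    fix b b' x y z t
    assume "b \<in> Y" "b' \<in> Y" and *: "b \<noteq> b'" "x \<in> b" "y \<in> b'" "z \<in> b" "t \<in> b'"
      "x < y" "y < z" "z < t"
    then have "b \<in> blocks \<pi>" "b' \<in> blocks \<pi>" using assms(1) by auto
    with * ncP show False unfolding noncrossing_def by meson
  qed
  have fS: "finite S"
    unfolding S_def by (rule finite_subset[OF _ blocks_finite[of \<pi>]]) (use assms(1) in auto)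
  have Sne: "S \<noteq> {}" using assms(2) Y(2) unfolding S_def by auto
  have mono: "rank S x < rank S y" if "y \<in> S" "x < y" for x y
  proof -
    have "y \<in> {z \<in> S. z \<le> y}" "y \<notin> {z \<in> S. z \<le> x}" using that by auto
    moreover have "{z \<in> S. z \<le> x} \<subseteq> {z \<in> S. z \<le> y}" using that by auto
    ultimately show ?thesis unfolding rank_def using fS by (intro psubset_card_mono) auto
  qed
  have less: "rank S x < rank S y \<longleftrightarrow> x < y" if "x \<in> S" "y \<in> S" for x y
    using mono[of y x] mono[of x y] that by (metis linorder_neqE_nat order_less_asym)
  have inj: "inj_on (rank S) S"
    by (rule inj_onI) (metis less order_less_irrefl linorder_neqE_nat)
  have sub: "rank S ` S \<subseteq> {1..card S}"
  proof
    fix k assume "k \<in> rank S ` S"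
    then obtain x where x: "x \<in> S" "k = rank S x" by auto
    have "x \<in> {y \<in> S. y \<le> x}" using x by auto
    then have "0 < rank S x" unfolding rank_def using fS card_gt_0_iff by fastforce
    moreover have "rank S x \<le> card S" unfolding rank_def by (rule card_mono) (use fS in auto)
    ultimately show "k \<in> {1..card S}" using x by auto
  qed
  have img: "rank S ` S = {1..card S}"
    by (rule card_subset_eq) (use sub inj in \<open>auto simp: card_image\<close>)
  have dis: "disjoint (renumber Y)"
  proof (unfold disjoint_def, intro ballI impI)
    fix c c' assume "c \<in> renumber Y" "c' \<in> renumber Y" and ne: "c \<noteq> c'"
    then obtain b b' where b: "b \<in> Y" "b' \<in> Y" "c = rank S ` b" "c' = rank S ` b'"
      unfolding renumber_def S_def by auto
    then have "b \<inter> b' = {}" using Y ne by (auto simp: disjoint_def)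
    then have "rank S ` (b \<inter> b') = {}" by simp
    moreover have "b \<subseteq> S" "b' \<subseteq> S" using b unfolding S_def by auto
    ultimately show "c \<inter> c' = {}" using b inj_on_image_Int[OF inj, of b b'] by simp
  qed
  have "\<Union>(renumber Y) = rank S ` S" unfolding renumber_def S_def by auto
  moreover have "{} \<notin> renumber Y" unfolding renumber_def using Y by auto
  ultimately have part: "partition_on {1..card S} (renumber Y)"
    using dis img by (auto simp: partition_on_def)
  have "noncrossing (renumber Y)"
    unfolding noncrossing_def
  proof (rule notI, elim bexE conjE)
    fix c c' x y z t
    assume "c \<in> renumber Y" "c' \<in> renumber Y" "c \<noteq> c'"
      and xyz: "x \<in> c" "y \<in> c'" "z \<in> c" "t \<in> c'" "x < y" "y < z" "z < t"
    then obtain b b' where b: "b \<in> Y" "b' \<in> Y" "b \<noteq> b'" "c = rank S ` b" "c' = rank S ` b'"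
      unfolding renumber_def S_def by auto
    then obtain x' y' z' t' where "x' \<in> b" "y' \<in> b'" "z' \<in> b" "t' \<in> b'"
      "x = rank S x'" "y = rank S y'" "z = rank S z'" "t = rank S t'"
      using xyz by auto
    moreover from this have "x' < y'" "y' < z'" "z' < t'"
      using xyz less b unfolding S_def by (metis UnionI)+
    ultimately show False using nc b(1-3) unfolding noncrossing_def by meson
  qed
  moreover have "card S \<ge> 1" using Sne fS by (simp add: Suc_le_eq card_gt_0_iff)
  ultimately show ?thesis using part by (intro Abs_ncp_inverse) auto
qed

lemma merge_ncp:
  assumes "r \<in> Ec \<pi>"
  shows "blocks (Abs_ncp (merge (blocks \<pi>) r)) = merge (blocks \<pi>) r"
proof -
  let ?P = "blocks \<pi>"
  obtain n where n: "n \<ge> 1" and P: "partition_on {1..n} ?P" using blocks[of \<pi>] by auto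
  have r: "equiv ?P r" and nc: "noncrossing (merge ?P r)" using assms unfolding Ec_def by auto
  have "\<Union>(merge ?P r) = \<Union>(\<Union>(?P // r))" unfolding merge_def by auto
  then have un: "\<Union>(merge ?P r) = {1..n}"
    using P unfolding partition_on_def Union_quotient[OF r] by simp
  have "{} \<notin> merge ?P r"
  proof
    assume "{} \<in> merge ?P r"
    then obtain C where C: "C \<in> ?P // r" "\<Union>C = {}" unfolding merge_def by auto
    then have "C \<noteq> {}" "C \<subseteq> ?P"
      using in_quotient_imp_non_empty[OF r] in_quotient_imp_subset[OF r] by auto
    then show False using C P unfolding partition_on_def by auto
  qed
  moreover have "disjoint (merge ?P r)"
  proof (unfold disjoint_def, intro ballI impI)
    fix c c' assume "c \<in> merge ?P r" "c' \<in> merge ?P r" and ne: "c \<noteq> c'"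
    then obtain C C' where C: "C \<in> ?P // r" "C' \<in> ?P // r" "c = \<Union>C" "c' = \<Union>C'"
      unfolding merge_def by auto
    then have "C \<inter> C' = {}" using quotient_disj[OF r, of C C'] ne by auto
    moreover have "C \<subseteq> ?P" "C' \<subseteq> ?P" using C in_quotient_imp_subset[OF r] by auto
    moreover have "disjoint ?P" using P unfolding partition_on_def by simp
    ultimately have "b \<inter> b' = {}" if "b \<in> C" "b' \<in> C'" for b b'
      using that unfolding disjoint_def by (metis disjoint_iff subsetD)
    then show "c \<inter> c' = {}" using C by auto
  qed
  ultimately show ?thesis
    using un n nc by (intro Abs_ncp_inverse) (auto simp: partition_on_def)
qed


section \<open>Algebras and tensor products\<close>

text \<open>
  The free commutative algebra on \<^typ>\<open>ncp\<close> is the monoid algebra of the free commutative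
  monoid on \<^typ>\<open>ncp\<close>: monomials are multisets, and multiplication is the
  convolution product of \<^theory>\<open>HOL-Library.Poly_Mapping\<close>. The tensor product of two
  monoid algebras is the monoid algebra of the product monoid, so that it has basis
  \<open>a \<otimes> b = (a, b)\<close> and product \<open>(a \<otimes> b)(a' \<otimes> b') = aa' \<otimes> bb'\<close>. In the same way
  \<open>K[X] \<otimes> K[X]\<close> has basis \<open>X\<^sup>i \<otimes> X\<^sup>j = (i, j)\<close>. The scalar \<open>c\<close> is
  \<open>Poly_Mapping.single 0 c\<close> in a monoid algebra and \<open>[:c:]\<close> in \<open>K[X]\<close>.
\<close>

type_synonym 'k ncp_alg = "ncp multiset \<Rightarrow>\<^sub>0 'k"
type_synonym 'k ncp_alg2 = "ncp multiset \<times> ncp multiset \<Rightarrow>\<^sub>0 'k"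
type_synonym 'k poly2 = "nat \<times> nat \<Rightarrow>\<^sub>0 'k"

definition gen :: "ncp \<Rightarrow> 'k::field_char_0 ncp_alg" where
  "gen \<pi> = Poly_Mapping.single {#\<pi>#} 1"

definition tens :: "('a \<Rightarrow>\<^sub>0 'k::field_char_0) \<Rightarrow> ('b \<Rightarrow>\<^sub>0 'k) \<Rightarrow> ('a \<times> 'b \<Rightarrow>\<^sub>0 'k)" where
  "tens x y = (\<Sum>a\<in>Poly_Mapping.keys x. \<Sum>b\<in>Poly_Mapping.keys y.
     Poly_Mapping.single (a, b) (Poly_Mapping.lookup x a * Poly_Mapping.lookup y b))"

definition poly_tens :: "'k::field_char_0 poly \<Rightarrow> 'k poly \<Rightarrow> 'k poly2" where
  "poly_tens p q = (\<Sum>i\<le>degree p. \<Sum>j\<le>degree q.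
     Poly_Mapping.single (i, j) (coeff p i * coeff q j))"

text \<open>The linear map \<open>\<phi> \<otimes> \<phi>\<close>, for linear \<open>\<phi>\<close>.\<close>

definition tensor_map :: "('k::field_char_0 ncp_alg \<Rightarrow> 'k poly) \<Rightarrow> 'k ncp_alg2 \<Rightarrow> 'k poly2" where
  "tensor_map \<phi> t = (\<Sum>(a, b)\<in>Poly_Mapping.keys t.
     Poly_Mapping.single 0 (Poly_Mapping.lookup t (a, b)) *
     poly_tens (\<phi> (Poly_Mapping.single a 1)) (\<phi> (Poly_Mapping.single b 1)))"

text \<open>
  The algebra morphism that extends \<open>F\<close>, with values in the commutative algebra
  whose structure map is \<open>s\<close>.
\<close>

definition alg_ext ::
  "('k::field_char_0 \<Rightarrow> 'r::comm_ring_1) \<Rightarrow> (ncp \<Rightarrow> 'r) \<Rightarrow> 'k ncp_alg \<Rightarrow> 'r" where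
  "alg_ext s F x = (\<Sum>M\<in>Poly_Mapping.keys x.
     s (Poly_Mapping.lookup x M) * (\<Prod>\<pi>\<in>#M. F \<pi>))"


section \<open>The double bialgebra of noncrossing partitions\<close>

definition restr :: "nat set set \<Rightarrow> 'k::field_char_0 ncp_alg" where
  "restr Y = (if Y = {} then 1 else gen (Abs_ncp (renumber Y)))"

definition restr_ideal :: "nat set set \<Rightarrow> 'k::field_char_0 ncp_alg" where
  "restr_ideal J = (\<Prod>I\<in>components (\<Union>J). restr {b \<in> J. b \<subseteq> I})"

definition restr_classes ::
  "ncp \<Rightarrow> (nat set \<times> nat set) set \<Rightarrow> 'k::field_char_0 ncp_alg" where
  "restr_classes \<pi> r = (\<Prod>C\<in>blocks \<pi> // r. restr C)"

definition Delta_ncp :: "'k::field_char_0 ncp_alg \<Rightarrow> 'k ncp_alg2" where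
  "Delta_ncp = alg_ext (Poly_Mapping.single 0)
     (\<lambda>\<pi>. \<Sum>J\<in>ideals \<pi>. tens (restr (blocks \<pi> - J)) (restr_ideal J))"

definition delta_ncp :: "'k::field_char_0 ncp_alg \<Rightarrow> 'k ncp_alg2" where
  "delta_ncp = alg_ext (Poly_Mapping.single 0)
     (\<lambda>\<pi>. \<Sum>r\<in>Ec \<pi>. tens (gen (Abs_ncp (merge (blocks \<pi>) r))) (restr_classes \<pi> r))"

definition eps_Delta_ncp :: "'k::field_char_0 ncp_alg \<Rightarrow> 'k" where
  "eps_Delta_ncp = alg_ext (\<lambda>c. c) (\<lambda>\<pi>. 0)"

definition eps_delta_ncp :: "'k::field_char_0 ncp_alg \<Rightarrow> 'k" where
  "eps_delta_ncp = alg_ext (\<lambda>c. c) (\<lambda>\<pi>. if card (blocks \<pi>) = 1 then 1 else 0)"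


section \<open>The double bialgebra of polynomials\<close>

text \<open>
  The coproducts are multiplicative, hence given by substitution of
  \<open>X \<otimes> 1 + 1 \<otimes> X\<close> and of \<open>X \<otimes> X\<close>.
\<close>

abbreviation polyX :: "'k::field_char_0 poly" where
  "polyX \<equiv> [:0, 1:]"

definition Delta_poly :: "'k::field_char_0 poly \<Rightarrow> 'k poly2" where
  "Delta_poly p =
     poly (map_poly (Poly_Mapping.single 0) p) (poly_tens polyX 1 + poly_tens 1 polyX)"

definition delta_poly :: "'k::field_char_0 poly \<Rightarrow> 'k poly2" where
  "delta_poly p = poly (map_poly (Poly_Mapping.single 0) p) (poly_tens polyX polyX)"

definition eps_Delta_poly :: "'k::field_char_0 poly \<Rightarrow> 'k" where
  "eps_Delta_poly p = poly p 0"

definition eps_delta_poly :: "'k::field_char_0 poly \<Rightarrow> 'k" where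
  "eps_delta_poly p = poly p 1"


section \<open>Double bialgebra morphisms\<close>

definition algebra_morphism :: "('k::field_char_0 ncp_alg \<Rightarrow> 'k poly) \<Rightarrow> bool" where
  "algebra_morphism \<phi> \<longleftrightarrow>
     (\<forall>c. \<phi> (Poly_Mapping.single 0 c) = [:c:]) \<and>
     (\<forall>x y. \<phi> (x + y) = \<phi> x + \<phi> y) \<and>
     (\<forall>x y. \<phi> (x * y) = \<phi> x * \<phi> y)"

definition double_bialgebra_morphism :: "('k::field_char_0 ncp_alg \<Rightarrow> 'k poly) \<Rightarrow> bool" where
  "double_bialgebra_morphism \<phi> \<longleftrightarrow>
     algebra_morphism \<phi> \<and>
     (\<forall>x. Delta_poly (\<phi> x) = tensor_map \<phi> (Delta_ncp x)) \<and>
     (\<forall>x. delta_poly (\<phi> x) = tensor_map \<phi> (delta_ncp x)) \<and>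
     (\<forall>x. eps_Delta_poly (\<phi> x) = eps_Delta_ncp x) \<and>
     (\<forall>x. eps_delta_poly (\<phi> x) = eps_delta_ncp x)"

end

theory Submission
  imports Defs
begin

text \<open>
  Both sides satisfy the same recursion in \<open>n\<close>, starting from the value \<open>0\<close> at \<open>n = 0\<close>.

  On the algebraic side, compatibility of \<open>\<phi>\<close> with \<open>\<Delta>\<close>, evaluated at the point \<open>(n, 1)\<close>, gives
  \<open>\<phi>(\<pi>)(n + 1) = \<Sum>\<^sub>J \<phi>(\<pi> restricted to \<pi> - J)(n) \<cdot> \<phi>(restr_ideal J)(1)\<close>, the sum running over the
  ideals \<open>J\<close> of \<open>\<pi>\<close> (\<open>morphism_gen_at_sum\<close>). As \<open>\<phi>\<close> respects the counits attached to \<open>\<delta>\<close>, the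
  value of \<open>\<phi>(x)\<close> at \<open>1\<close> is the counit of \<open>x\<close>, so the last factor is \<open>1\<close> if every maximal interval of \<open>\<Union>J\<close> contains a
  single block and \<open>0\<close> otherwise; the recursion therefore only sees the ideals whose blocks are
  intervals that do not touch each other (\<open>morphism_restr_ideal_at_one\<close>,
  \<open>isolated_iff_components\<close>).

  On the combinatorial side, split a colouring with \<open>n + 1\<close> colours by the set \<open>J\<close> of blocks that
  have the largest colour. Strict monotonicity for nesting forces \<open>J\<close> to be an ideal without
  nested blocks, and the condition on pairs of equal colour, for the colour \<open>n + 1\<close>, says that
  between two blocks of \<open>J\<close> there is an element of a block outside \<open>J\<close>: these are the same \<open>J\<close>.
  What remains is a colouring of \<open>\<pi> - J\<close> with \<open>n\<close> colours, and nothing else is required of it,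
  because the block that separates two blocks of the same colour has a smaller colour
  and so never lies in \<open>J\<close> (\<open>admissible_split_top\<close>, \<open>card_colourings_Suc\<close>).

  The double bialgebra renumbers the elements that are left after a restriction. Admissibility
  only refers to the relative order of the elements, so renumbering does not change the count
  (\<open>card_colourings_renumber\<close>).
\<close>

section \<open>Linear extension and evaluation of tensors\<close>

definition lin_ext :: "('a \<Rightarrow> 'k::field_char_0) \<Rightarrow> ('a \<Rightarrow>\<^sub>0 'k) \<Rightarrow> 'k" where
  "lin_ext w t = (\<Sum>a\<in>Poly_Mapping.keys t. Poly_Mapping.lookup t a * w a)"

lemma lin_ext_zero [simp]: "lin_ext w 0 = 0"
  by (simp add: lin_ext_def)

lemma lin_ext_single [simp]: "lin_ext w (Poly_Mapping.single a c) = c * w a"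
  by (simp add: lin_ext_def)

lemma lin_ext_add: "lin_ext w (s + t) = lin_ext w s + lin_ext w t"
  unfolding lin_ext_def by (rule setsum_keys_plus_distrib) (auto simp: algebra_simps)

lemma lin_ext_sum: "lin_ext w (\<Sum>i\<in>A. f i) = (\<Sum>i\<in>A. lin_ext w (f i))"
  by (induction A rule: infinite_finite_induct) (auto simp: lin_ext_add)

lemma sum_single_lookup:
  "(\<Sum>a\<in>Poly_Mapping.keys t. Poly_Mapping.single a (Poly_Mapping.lookup t a)) = t"
proof (rule poly_mapping_eqI)
  fix k
  show "Poly_Mapping.lookup (\<Sum>a\<in>Poly_Mapping.keys t.
      Poly_Mapping.single a (Poly_Mapping.lookup t a)) k = Poly_Mapping.lookup t k"
    by (auto simp: lookup_sum lookup_single when_def sum.delta' in_keys_iff)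
qed

lemma lin_ext_mult:
  fixes w :: "'a::monoid_add \<Rightarrow> 'k::field_char_0"
  assumes "\<And>a b. w (a + b) = w a * w b"
  shows "lin_ext w (s * t) = lin_ext w s * lin_ext w t"
proof -
  have "lin_ext w (s * t) = lin_ext w
      ((\<Sum>a\<in>Poly_Mapping.keys s. Poly_Mapping.single a (Poly_Mapping.lookup s a)) *
       (\<Sum>b\<in>Poly_Mapping.keys t. Poly_Mapping.single b (Poly_Mapping.lookup t b)))"
    by (simp only: sum_single_lookup)
  also have "\<dots> = lin_ext w s * lin_ext w t"
    by (simp add: sum_product mult_single lin_ext_sum assms lin_ext_def[of w s]
        lin_ext_def[of w t] mult_ac)
  finally show ?thesis .
qed

definition eval2 :: "'k::field_char_0 \<Rightarrow> 'k \<Rightarrow> 'k poly2 \<Rightarrow> 'k" where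
  "eval2 u v = lin_ext (\<lambda>(i, j). u ^ i * v ^ j)"

lemma eval2_single_zero: "eval2 u v (Poly_Mapping.single 0 c) = c"
  by (simp add: eval2_def zero_prod_def)

lemma eval2_zero: "eval2 u v 0 = 0"
  by (simp add: eval2_def)

lemma eval2_add: "eval2 u v (s + t) = eval2 u v s + eval2 u v t"
  by (simp add: eval2_def lin_ext_add)

lemma eval2_mult: "eval2 u v (s * t) = eval2 u v s * eval2 u v t"
  unfolding eval2_def
  by (rule lin_ext_mult) (auto simp: power_add mult_ac split: prod.splits)

lemma eval2_poly_tens: "eval2 u v (poly_tens p q) = poly p u * poly q v"
  by (simp add: eval2_def poly_tens_def lin_ext_sum poly_altdef sum_product mult_ac)

text \<open>
  Evaluation at \<open>(u, v)\<close> is a ring morphism that fixes scalars, so it commutes with substituting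
  \<open>X \<otimes> 1 + 1 \<otimes> X\<close> into a polynomial, and that element goes to \<open>u + v\<close>.
\<close>

lemma eval2_Delta_poly: "eval2 u v (Delta_poly p) = poly p (u + v)"
proof -
  have "eval2 u v (poly (map_poly (Poly_Mapping.single 0) p) T) = poly p (eval2 u v T)" for T
    by (induction p)
      (auto simp: map_poly_pCons eval2_zero eval2_add eval2_mult eval2_single_zero)
  then show ?thesis
    by (simp add: Delta_poly_def eval2_add eval2_poly_tens)
qed

text \<open>
  This writes the linear map \<open>x \<mapsto> \<phi>(x)(u)\<close> through its values on monomials, the form in which
  \<^const>\<open>tensor_map\<close> uses \<open>\<phi>\<close>.
\<close>

lemma algebra_morphism_expand:
  assumes "algebra_morphism \<phi>"
  shows "poly (\<phi> x) u = lin_ext (\<lambda>a. poly (\<phi> (Poly_Mapping.single a 1)) u) x"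
proof -
  have single: "\<phi> (Poly_Mapping.single a c) = smult c (\<phi> (Poly_Mapping.single a 1))" for a c
  proof -
    have "\<phi> (Poly_Mapping.single 0 c * Poly_Mapping.single a 1)
        = [:c:] * \<phi> (Poly_Mapping.single a 1)"
      using assms unfolding algebra_morphism_def by metis
    then show ?thesis by (simp add: mult_single)
  qed
  have zero: "\<phi> 0 = 0"
    using single[of _ 0] by simp
  have add: "\<phi> (y + z) = \<phi> y + \<phi> z" for y z
    using assms unfolding algebra_morphism_def by metis
  have sum: "\<phi> (\<Sum>i\<in>A. f i) = (\<Sum>i\<in>A. \<phi> (f i))" for A :: "ncp multiset set" and f
    by (induction A rule: infinite_finite_induct) (auto simp: zero add)
  have "\<phi> x = (\<Sum>a\<in>Poly_Mapping.keys x.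
      smult (Poly_Mapping.lookup x a) (\<phi> (Poly_Mapping.single a 1)))"
    by (subst sum_single_lookup[of x, symmetric]) (simp only: sum single[symmetric])
  then show ?thesis
    by (simp add: lin_ext_def poly_sum)
qed

lemma eval2_tensor_map:
  "eval2 u v (tensor_map \<phi> t) = lin_ext
     (\<lambda>(a, b). poly (\<phi> (Poly_Mapping.single a 1)) u * poly (\<phi> (Poly_Mapping.single b 1)) v) t"
proof -
  have *: "eval2 u v (\<Sum>i\<in>A. f i) = (\<Sum>i\<in>A. eval2 u v (f i))" for A f
    by (simp add: eval2_def lin_ext_sum)
  show ?thesis
    unfolding tensor_map_def * lin_ext_def
    by (auto intro!: sum.cong simp: eval2_mult eval2_single_zero eval2_poly_tens)
qed

lemma eval2_tensor_map_tens:
  assumes "algebra_morphism \<phi>"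
  shows "eval2 u v (tensor_map \<phi> (\<Sum>i\<in>A. tens (x i) (y i)))
       = (\<Sum>i\<in>A. poly (\<phi> (x i)) u * poly (\<phi> (y i)) v)"
  unfolding eval2_tensor_map algebra_morphism_expand[OF assms, of "x _"]
    algebra_morphism_expand[OF assms, of "y _"]
  by (simp add: lin_ext_sum tens_def sum_product lin_ext_def[of _ "x _"]
      lin_ext_def[of _ "y _"] mult_ac)

section \<open>Double bialgebra morphisms on generators\<close>

lemma alg_ext_gen:
  assumes "s 1 = 1"
  shows "alg_ext s F (gen \<pi>) = F \<pi>"
  using assms by (simp add: alg_ext_def gen_def)

text \<open>
  Compatibility of \<open>\<phi>\<close> with \<open>\<Delta>\<close>, read pointwise: \<open>\<Delta>\<close> on polynomials is \<open>P(X) \<mapsto> P(X + Y)\<close>.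
\<close>

lemma morphism_gen_at_sum:
  assumes "double_bialgebra_morphism \<phi>"
  shows "poly (\<phi> (gen \<pi>)) (u + v) = (\<Sum>J\<in>ideals \<pi>.
      poly (\<phi> (restr (blocks \<pi> - J))) u * poly (\<phi> (restr_ideal J)) v)"
proof -
  have am: "algebra_morphism \<phi>" and D: "Delta_poly (\<phi> x) = tensor_map \<phi> (Delta_ncp x)" for x
    using assms unfolding double_bialgebra_morphism_def by auto
  have "poly (\<phi> (gen \<pi>)) (u + v) = eval2 u v (tensor_map \<phi> (Delta_ncp (gen \<pi>)))"
    by (simp only: D[symmetric] eval2_Delta_poly)
  also have "Delta_ncp (gen \<pi>) =
      (\<Sum>J\<in>ideals \<pi>. tens (restr (blocks \<pi> - J)) (restr_ideal J :: 'a ncp_alg))"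
    unfolding Delta_ncp_def by (rule alg_ext_gen) simp
  finally show ?thesis
    by (simp only: eval2_tensor_map_tens[OF am])
qed

lemma morphism_one:
  assumes "algebra_morphism \<phi>"
  shows "\<phi> 1 = 1"
  using assms unfolding algebra_morphism_def by (metis one_pCons single_one)

lemma morphism_prod:
  assumes "algebra_morphism \<phi>"
  shows "\<phi> (\<Prod>i\<in>A. f i) = (\<Prod>i\<in>A. \<phi> (f i))"
  using assms
  by (induction A rule: infinite_finite_induct)
    (auto simp: morphism_one algebra_morphism_def)

lemma morphism_gen_at_zero:
  assumes "double_bialgebra_morphism \<phi>"
  shows "poly (\<phi> (gen \<pi>)) 0 = 0"
  using assms
  by (simp add: double_bialgebra_morphism_def eps_Delta_poly_def eps_Delta_ncp_def alg_ext_gen)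

lemma morphism_gen_at_one:
  assumes "double_bialgebra_morphism \<phi>"
  shows "poly (\<phi> (gen \<pi>)) 1 = (if card (blocks \<pi>) = 1 then 1 else 0)"
proof -
  have "eps_delta_poly (\<phi> (gen \<pi>)) = eps_delta_ncp (gen \<pi>)"
    using assms by (simp only: double_bialgebra_morphism_def)
  then show ?thesis
    by (simp add: eps_delta_poly_def eps_delta_ncp_def alg_ext_gen)
qed

section \<open>Geometry of blocks\<close>

lemma blocks_props:
  shows finite_blocks: "finite (blocks \<pi>)"
    and finite_block: "b \<in> blocks \<pi> \<Longrightarrow> finite b"
    and block_nonempty: "b \<in> blocks \<pi> \<Longrightarrow> b \<noteq> {}"
    and blocks_nonempty: "blocks \<pi> \<noteq> {}"
    and blocks_disjoint: "\<lbrakk>b \<in> blocks \<pi>; c \<in> blocks \<pi>; x \<in> b; x \<in> c\<rbrakk> \<Longrightarrow> b = c"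
    and noncrossing_blocks: "noncrossing (blocks \<pi>)"
    and blocks_cover: "\<lbrakk>b \<in> blocks \<pi>; c \<in> blocks \<pi>; x \<in> b; z \<in> c; x \<le> y; y \<le> z\<rbrakk>
      \<Longrightarrow> y \<in> \<Union>(blocks \<pi>)"
proof -
  obtain n where n: "n \<ge> 1" and P: "partition_on {1..n} (blocks \<pi>)"
    and nc: "noncrossing (blocks \<pi>)"
    using blocks[of \<pi>] by auto
  have U: "\<Union>(blocks \<pi>) = {1..n}" using P by (simp add: partition_on_def)
  show "finite (blocks \<pi>)" by (rule finite_UnionD[OF blocks_finite])
  show "b \<in> blocks \<pi> \<Longrightarrow> finite b"
    by (rule finite_subset[OF _ blocks_finite[of \<pi>]]) auto
  show "b \<in> blocks \<pi> \<Longrightarrow> b \<noteq> {}" using P by (auto simp: partition_on_def)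
  show "blocks \<pi> \<noteq> {}" using U n by auto
  show "b = c" if "b \<in> blocks \<pi>" "c \<in> blocks \<pi>" "x \<in> b" "x \<in> c"
    using P that unfolding partition_on_def disjoint_def by blast
  show "noncrossing (blocks \<pi>)" by (rule nc)
  show "y \<in> \<Union>(blocks \<pi>)" if "b \<in> blocks \<pi>" "c \<in> blocks \<pi>" "x \<in> b" "z \<in> c" "x \<le> y" "y \<le> z"
  proof -
    have "x \<in> {1..n}" "z \<in> {1..n}" using that U by blast+
    then show ?thesis using that U by auto
  qed
qed

lemma Min_block: "b \<in> blocks \<pi> \<Longrightarrow> Min b \<in> b"
  and Max_block: "b \<in> blocks \<pi> \<Longrightarrow> Max b \<in> b"
  by (simp_all add: finite_block block_nonempty)

lemma block_bounds: "b \<in> blocks \<pi> \<Longrightarrow> x \<in> b \<Longrightarrow> Min b \<le> x \<and> x \<le> Max b"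
  by (simp add: finite_block)

text \<open>
  By the noncrossing condition, a block that meets the hull of \<open>b\<close> cannot leave it: with a point
  outside the hull it would cross \<open>b\<close> at one of the endpoints \<open>Min b\<close>, \<open>Max b\<close>.
\<close>

lemma nest_if_meets:
  assumes b: "b \<in> blocks \<pi>" and c: "c \<in> blocks \<pi>" and "b \<noteq> c"
    and x: "x \<in> c" "Min b \<le> x" "x \<le> Max b"
  shows "nest b c"
  unfolding nest_def
proof
  fix y assume y: "y \<in> c"
  have out: "Min b \<notin> c" "Max b \<notin> c"
    using blocks_disjoint[OF b c] \<open>b \<noteq> c\<close> Min_block[OF b] Max_block[OF b] by blast+
  then have lt: "Min b < x" "x < Max b"
    using x by (metis le_neq_implies_less)+
  have nc: False if "d \<in> blocks \<pi>" "e \<in> blocks \<pi>" "d \<noteq> e" "p \<in> d" "q \<in> e" "r \<in> d" "s \<in> e"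
    "p < q" "q < r" "r < s" for d e p q r s
    using noncrossing_blocks[of \<pi>] that unfolding noncrossing_def by meson
  have "\<not> y < Min b"
    using nc[of c b y "Min b" x "Max b"] b c \<open>b \<noteq> c\<close> y x Min_block[OF b] Max_block[OF b] lt
    by metis
  moreover have "\<not> Max b < y"
    using nc[of b c "Min b" x "Max b" y] b c \<open>b \<noteq> c\<close> y x Min_block[OF b] Max_block[OF b] lt
    by metis
  ultimately show "y \<in> {Min b..Max b}" by simp
qed

lemma blocks_trichotomy:
  assumes b: "b \<in> blocks \<pi>" and c: "c \<in> blocks \<pi>" and "b \<noteq> c"
  shows "nest b c \<or> nest c b \<or> Max b < Min c \<or> Max c < Min b"
proof (cases "Min b \<le> Min c")
  case True
  then show ?thesis
    using nest_if_meets[OF b c \<open>b \<noteq> c\<close> Min_block[OF c]] by (meson not_less)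
next
  case False
  then show ?thesis
    using nest_if_meets[OF c b _ Min_block[OF b]] \<open>b \<noteq> c\<close> by (metis nat_le_linear not_less)
qed

text \<open>
  Blocks that meet the hull of \<open>b\<close> are nested in \<open>b\<close>, and an ideal contains all of them. Hence a
  maximal interval of \<open>\<Union>J\<close> never cuts a block of \<open>J\<close>.
\<close>

lemma ideal_hull:
  assumes J: "J \<in> ideals \<pi>" and b: "b \<in> J"
  shows "{Min b..Max b} \<subseteq> \<Union>J"
proof
  fix x assume x: "x \<in> {Min b..Max b}"
  have bP: "b \<in> blocks \<pi>" using J b unfolding ideals_def by auto
  obtain c where c: "c \<in> blocks \<pi>" "x \<in> c"
    using blocks_cover[OF bP bP Min_block[OF bP] Max_block[OF bP]] x by auto
  have "c \<in> J"
  proof (cases "c = b")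
    case False
    then have "nest b c" using nest_if_meets[OF bP c(1) _ c(2)] x by auto
    then show ?thesis using J b c unfolding ideals_def by auto
  qed (use b in simp)
  then show "x \<in> \<Union>J" using c by auto
qed

lemma finite_components:
  assumes "finite S"
  shows "finite (components S)"
  by (rule finite_subset[of _ "Pow S"]) (use assms in \<open>auto simp: components_def\<close>)

lemma interval_in_component:
  assumes "finite S" "a \<le> b" "{a..b} \<subseteq> S"
  shows "\<exists>I\<in>components S. {a..b} \<subseteq> I"
proof -
  define A where "A = {I. (\<exists>c d. c \<le> d \<and> I = {c..d}) \<and> I \<subseteq> S \<and> {a..b} \<subseteq> I}"
  have "A \<subseteq> Pow S" unfolding A_def by blast
  then have "finite A" by (rule finite_subset) (simp add: assms(1))
  moreover have "{a..b} \<in> A" unfolding A_def using assms by blast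
  ultimately obtain I where I: "I \<in> A" and max: "\<forall>K\<in>A. I \<subseteq> K \<longrightarrow> I = K"
    using finite_has_maximal2[of A "{a..b}"] by auto
  have "I \<in> components S"
    unfolding components_def
  proof (intro CollectI conjI allI impI)
    show "\<exists>c d. c \<le> d \<and> I = {c..d}" and "I \<subseteq> S" using I unfolding A_def by auto
    fix c d assume cd: "I \<subseteq> {c..d} \<and> {c..d} \<subseteq> S"
    then have sub: "{a..b} \<subseteq> {c..d}" using I unfolding A_def by auto
    then have "c \<le> d" using assms(2) by auto
    then have "{c..d} \<in> A" unfolding A_def using cd sub by blast
    then show "{c..d} = I" using max cd by blast
  qed
  then show ?thesis using I unfolding A_def by blast
qed

text \<open>
  For an ideal \<open>J\<close> this says that the blocks of \<open>J\<close> are pairwise non-adjacent intervals. It is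
  phrased in the terms of the colouring conditions, of which it is the restriction to the
  largest colour.
\<close>

definition isolated :: "nat set set \<Rightarrow> bool" where
  "isolated J \<longleftrightarrow> (\<forall>b\<in>J. \<forall>b'\<in>J.
     (nest b b' \<longrightarrow> b = b') \<and> (Max b < Min b' \<longrightarrow> \<not> {Max b<..<Min b'} \<subseteq> \<Union>J))"

text \<open>
  Two blocks in one maximal interval of \<open>\<Union>J\<close> are either nested or separated by a gap that \<open>\<Union>J\<close>
  fills. Conversely, a nested pair, or a pair with a filled gap, lies in one interval contained in
  \<open>\<Union>J\<close>, because \<open>\<Union>J\<close> contains the hulls of its blocks.
\<close>

lemma isolated_iff_components:
  assumes J: "J \<in> ideals \<pi>"
  shows "isolated J \<longleftrightarrow> (\<forall>I\<in>components (\<Union>J). card {b \<in> J. b \<subseteq> I} \<le> 1)"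
proof -
  have JP: "b \<in> blocks \<pi>" if "b \<in> J" for b using J that unfolding ideals_def by auto
  then have finJ: "finite J" and finU: "finite (\<Union>J)"
    using finite_subset[OF _ finite_blocks[of \<pi>], of J] finite_block by auto
  have card_iff: "card {b \<in> J. b \<subseteq> I} \<le> 1 \<longleftrightarrow> (\<forall>b\<in>J. \<forall>c\<in>J. b \<subseteq> I \<and> c \<subseteq> I \<longrightarrow> b = c)" for I
  proof -
    have "finite {b \<in> J. b \<subseteq> I}" using finJ by simp
    from card_le_Suc0_iff_eq[OF this] show ?thesis unfolding One_nat_def by blast
  qed
  have hull: "b \<subseteq> {Min b..Max b}" if "b \<in> J" for b
    using block_bounds[OF JP[OF that]] by auto
  show ?thesis
    unfolding card_iff
  proof (intro iffI ballI impI)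
    fix I b c
    assume iso: "isolated J" and I: "I \<in> components (\<Union>J)" and b: "b \<in> J" and c: "c \<in> J"
      and bc: "b \<subseteq> I \<and> c \<subseteq> I"
    have gap: False if d: "d \<in> J" and e: "e \<in> J" and de: "d \<subseteq> I" "e \<subseteq> I" "Max d < Min e" for d e
    proof -
      have "Max d \<in> I" "Min e \<in> I"
        using de Max_block[OF JP[OF d]] Min_block[OF JP[OF e]] by auto
      then have "{Max d<..<Min e} \<subseteq> I" using I unfolding components_def by auto
      also have "I \<subseteq> \<Union>J" using I unfolding components_def by blast
      finally show False using iso d e de unfolding isolated_def by blast
    qed
    show "b = c"
    proof (rule ccontr)
      assume "b \<noteq> c"
      then have "Max b < Min c \<or> Max c < Min b"
        using blocks_trichotomy[OF JP[OF b] JP[OF c]] iso b c unfolding isolated_def by auto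
      then show False using gap[of b c] gap[of c b] b c bc by blast
    qed
  next
    assume comp: "\<forall>I\<in>components (\<Union>J). \<forall>b\<in>J. \<forall>c\<in>J. b \<subseteq> I \<and> c \<subseteq> I \<longrightarrow> b = c"
    have same: "b = c" if b: "b \<in> J" and c: "c \<in> J" and
      pq: "{p..q} \<subseteq> \<Union>J" "b \<subseteq> {p..q}" "c \<subseteq> {p..q}" for b c p q
    proof -
      have "p \<le> q" using pq(2) Min_block[OF JP[OF b]] by auto
      then obtain I where "I \<in> components (\<Union>J)" "{p..q} \<subseteq> I"
        using interval_in_component[OF finU _ pq(1)] by blast
      then have "b \<subseteq> I" "c \<subseteq> I" using pq by simp_all
      then show ?thesis using comp b c \<open>I \<in> _\<close> by simp
    qed
    show "isolated J"
      unfolding isolated_def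
    proof (intro ballI conjI impI notI)
      fix b c assume b: "b \<in> J" and c: "c \<in> J"
      show "b = c" if "nest b c"
        using same[OF b c ideal_hull[OF J b] hull[OF b]] that by (simp add: nest_def)
      show False if lt: "Max b < Min c" and sub: "{Max b<..<Min c} \<subseteq> \<Union>J"
      proof -
        have le: "Min b \<le> Max b" "Min c \<le> Max c"
          using block_bounds Max_block JP b c by blast+
        have "{Min b..Max c} \<subseteq> {Min b..Max b} \<union> {Max b<..<Min c} \<union> {Min c..Max c}"
          by auto
        then have U: "{Min b..Max c} \<subseteq> \<Union>J"
          using sub ideal_hull[OF J b] ideal_hull[OF J c] by blast
        have "b \<subseteq> {Min b..Max c}" "c \<subseteq> {Min b..Max c}"
          using hull[OF b] hull[OF c] lt le by fastforce+
        then have "b = c" by (rule same[OF b c U])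
        then show False using lt le by simp
      qed
    qed
  qed
qed

section \<open>Colourings\<close>

definition admissible :: "nat set set \<Rightarrow> (nat set \<Rightarrow> nat) \<Rightarrow> bool" where
  "admissible P f \<longleftrightarrow> (\<forall>b\<in>P. \<forall>b'\<in>P.
     (nest b b' \<and> b \<noteq> b' \<longrightarrow> f b < f b') \<and>
     (f b = f b' \<and> Max b < Min b' \<longrightarrow>
       (\<exists>b''\<in>P. {Max b<..<Min b'} \<inter> b'' \<noteq> {} \<and> f b'' < f b)))"

definition colourings :: "nat set set \<Rightarrow> nat \<Rightarrow> (nat set \<Rightarrow> nat) set" where
  "colourings P n = {f \<in> P \<rightarrow>\<^sub>E {1..n}. admissible P f}"

lemma finite_colourings: "finite P \<Longrightarrow> finite (colourings P n)"
  by (simp add: colourings_def finite_PiE)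

lemma admissible_cong:
  assumes "\<And>b. b \<in> P \<Longrightarrow> f b = g b"
  shows "admissible P f \<longleftrightarrow> admissible P g"
  unfolding admissible_def by (intro ball_cong refl) (auto simp: assms)

text \<open>
  The largest colour decouples from the others. The gap condition for two blocks of smaller colour
  asks for a block of still smaller colour, which remains available when \<open>J\<close> is removed; for two
  blocks of \<open>J\<close> it asks for any block outside \<open>J\<close>, and every element of the gap belongs to
  some block. A block of \<open>J\<close> and a block outside \<open>J\<close> have different colours, and by the ideal
  property only the former can be nested in the latter.
\<close>

lemma admissible_split_top:
  assumes f: "\<And>b. b \<in> blocks \<pi> \<Longrightarrow> f b \<le> Suc n"
    and J: "J = {b \<in> blocks \<pi>. f b = Suc n}"
  shows "admissible (blocks \<pi>) f \<longleftrightarrow>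
     J \<in> ideals \<pi> \<and> isolated J \<and> admissible (blocks \<pi> - J) f"
proof (intro iffI)
  assume "admissible (blocks \<pi>) f"
  then have nest: "\<And>b c. b \<in> blocks \<pi> \<Longrightarrow> c \<in> blocks \<pi> \<Longrightarrow> nest b c \<Longrightarrow> b \<noteq> c \<Longrightarrow> f b < f c"
    and gap: "\<And>b c. b \<in> blocks \<pi> \<Longrightarrow> c \<in> blocks \<pi> \<Longrightarrow> f b = f c \<Longrightarrow> Max b < Min c \<Longrightarrow>
      \<exists>d\<in>blocks \<pi>. {Max b<..<Min c} \<inter> d \<noteq> {} \<and> f d < f b"
    unfolding admissible_def by blast+
  have top: "b = c" if "b \<in> J" "c \<in> blocks \<pi>" "nest b c" for b c
    using nest[of b c] f[of c] that unfolding J by fastforce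
  have "J \<in> ideals \<pi>"
    using top unfolding ideals_def by (auto simp: J)
  moreover have "isolated J"
    unfolding isolated_def
  proof (intro ballI conjI impI notI)
    fix b c assume b: "b \<in> J" and c: "c \<in> J"
    show "b = c" if "nest b c" using top[OF b _ that] c unfolding J by simp
    show False if lt: "Max b < Min c" and sub: "{Max b<..<Min c} \<subseteq> \<Union>J"
    proof -
      have "b \<in> blocks \<pi>" "c \<in> blocks \<pi>" "f b = f c" using b c unfolding J by simp_all
      from gap[OF this lt] obtain d x
        where d: "d \<in> blocks \<pi>" "x \<in> {Max b<..<Min c}" "x \<in> d" "f d < f b"
        by blast
      then obtain e where "e \<in> J" "x \<in> e" using sub by blast
      then have "d \<in> J" using blocks_disjoint[of d \<pi> e x] d unfolding J by auto
      then show False using d b unfolding J by simp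
    qed
  qed
  moreover have "admissible (blocks \<pi> - J) f"
    unfolding admissible_def
  proof (intro ballI conjI impI)
    fix b c assume bc: "b \<in> blocks \<pi> - J" "c \<in> blocks \<pi> - J"
    show "f b < f c" if "nest b c \<and> b \<noteq> c" using nest bc that by blast
    show "\<exists>d\<in>blocks \<pi> - J. {Max b<..<Min c} \<inter> d \<noteq> {} \<and> f d < f b"
      if "f b = f c \<and> Max b < Min c"
    proof -
      have "b \<in> blocks \<pi>" "c \<in> blocks \<pi>" "f b = f c" "Max b < Min c"
        using bc that by simp_all
      from gap[OF this] obtain d
        where d: "d \<in> blocks \<pi>" "{Max b<..<Min c} \<inter> d \<noteq> {}" "f d < f b"
        by blast
      then have "d \<notin> J" using f[of b] bc unfolding J by auto
      then show ?thesis using d by blast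
    qed
  qed
  ultimately show "J \<in> ideals \<pi> \<and> isolated J \<and> admissible (blocks \<pi> - J) f" by blast
next
  assume *: "J \<in> ideals \<pi> \<and> isolated J \<and> admissible (blocks \<pi> - J) f"
  have lt: "f b < Suc n" if "b \<in> blocks \<pi>" "b \<notin> J" for b
    using f[of b] that unfolding J by auto
  have eq: "f b = Suc n" if "b \<in> J" for b using that unfolding J by simp
  show "admissible (blocks \<pi>) f"
    unfolding admissible_def
  proof (intro ballI conjI impI)
    fix b c assume b: "b \<in> blocks \<pi>" and c: "c \<in> blocks \<pi>"
    show "f b < f c" if nest: "nest b c \<and> b \<noteq> c"
    proof (cases "b \<in> J")
      case True
      then have "c \<in> J" using * b c nest unfolding ideals_def by blast
      then show ?thesis using True * nest unfolding isolated_def by blast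
    next
      case False
      show ?thesis
      proof (cases "c \<in> J")
        case True
        then show ?thesis using lt[OF b False] eq by simp
      next
        assume "c \<notin> J"
        then show ?thesis using * b c False nest unfolding admissible_def by blast
      qed
    qed
    show "\<exists>d\<in>blocks \<pi>. {Max b<..<Min c} \<inter> d \<noteq> {} \<and> f d < f b"
      if same: "f b = f c \<and> Max b < Min c"
    proof (cases "b \<in> J")
      case True
      have "f c = Suc n" using same eq[OF True] by simp
      then have "c \<in> J" using c unfolding J by simp
      then have "\<not> {Max b<..<Min c} \<subseteq> \<Union>J"
        using * True same unfolding isolated_def by simp
      then obtain x where x: "x \<in> {Max b<..<Min c}" "x \<notin> \<Union>J" by blast
      obtain d where d: "d \<in> blocks \<pi>" "x \<in> d"
        using blocks_cover[OF b c Max_block[OF b] Min_block[OF c], of x] x by auto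
      then have "f d < f b" using lt[of d] x eq[OF True] by auto
      then show ?thesis using d x by blast
    next
      case False
      have "f c \<noteq> Suc n" using same lt[OF b False] by simp
      then have "c \<notin> J" unfolding J by simp
      then have "\<exists>d\<in>blocks \<pi> - J. {Max b<..<Min c} \<inter> d \<noteq> {} \<and> f d < f b"
        using * b c False same unfolding admissible_def by simp
      then show ?thesis by (meson DiffD1)
    qed
  qed
qed

text \<open>
  The colourings with top class \<open>J\<close> correspond to the colourings of the other blocks with one
  colour less: forget the top class in one direction, and give it the colour \<open>n + 1\<close> in the other.
\<close>

lemma card_colourings_Suc:
  "card (colourings (blocks \<pi>) (Suc n)) =
     (\<Sum>J\<in>{J \<in> ideals \<pi>. isolated J}. card (colourings (blocks \<pi> - J) n))"
proof -
  let ?P = "blocks \<pi>"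
  define fib where "fib J = {f \<in> colourings ?P (Suc n). {b \<in> ?P. f b = Suc n} = J}" for J
  let ?A = "{J \<in> ideals \<pi>. isolated J}"
  have finA: "finite ?A"
    by (rule finite_subset[of _ "Pow ?P"]) (auto simp: ideals_def finite_blocks)
  have split: "admissible ?P f \<longleftrightarrow> J \<in> ?A \<and> admissible (?P - J) f"
    if f: "f \<in> ?P \<rightarrow>\<^sub>E {1..Suc n}" and J: "{b \<in> ?P. f b = Suc n} = J" for f J
  proof -
    have "f b \<le> Suc n" if "b \<in> ?P" for b
      using PiE_mem[OF f that] by simp
    from admissible_split_top[OF this J[symmetric]] show ?thesis by simp
  qed
  have "{b \<in> ?P. f b = Suc n} \<in> ?A" if "f \<in> colourings ?P (Suc n)" for f
  proof -
    have "f \<in> ?P \<rightarrow>\<^sub>E {1..Suc n}" and "admissible ?P f"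
      using that unfolding colourings_def by auto
    with split[OF _ refl] show ?thesis by simp
  qed
  then have "colourings ?P (Suc n) = (\<Union>J\<in>?A. fib J)"
    unfolding fib_def by blast
  also have "card \<dots> = (\<Sum>J\<in>?A. card (fib J))"
    by (rule card_UN_disjoint[OF finA])
      (auto simp: fib_def intro: finite_subset[OF _ finite_colourings[OF finite_blocks]])
  also have "\<dots> = (\<Sum>J\<in>?A. card (colourings (?P - J) n))"
  proof (rule sum.cong[OF refl])
    fix J assume J: "J \<in> ?A"
    then have JP: "J \<subseteq> ?P" unfolding ideals_def by auto
    let ?r = "\<lambda>f. restrict f (?P - J)"
    let ?e = "\<lambda>g b. if b \<in> J then Suc n else g b"
    have e: "?e g \<in> fib J" if g: "g \<in> colourings (?P - J) n" for g
    proof -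
      have gP: "g \<in> (?P - J) \<rightarrow>\<^sub>E {1..n}" and adm: "admissible (?P - J) g"
        using g unfolding colourings_def by auto
      have val: "g b \<in> {1..n}" if "b \<in> ?P" "b \<notin> J" for b using PiE_mem[OF gP] that by auto
      have "g b \<noteq> Suc n" if "b \<in> ?P" "b \<notin> J" for b using val[OF that] by simp
      then have top: "{b \<in> ?P. ?e g b = Suc n} = J" using JP by auto
      have mem: "?e g \<in> ?P \<rightarrow>\<^sub>E {1..Suc n}"
      proof (rule PiE_I)
        show "?e g b \<in> {1..Suc n}" if "b \<in> ?P" for b
          using val[OF that] by auto
        show "?e g b = undefined" if "b \<notin> ?P" for b
          using PiE_arb[OF gP, of b] that JP by auto
      qed
      have "admissible (?P - J) (?e g)"
        using adm admissible_cong[of "?P - J" g "?e g"] by auto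
      then have "admissible ?P (?e g)"
        using split[OF mem top] J by simp
      then show ?thesis using mem top unfolding fib_def colourings_def by blast
    qed
    have r: "?r f \<in> colourings (?P - J) n" if f: "f \<in> fib J" for f
    proof -
      have fP: "f \<in> ?P \<rightarrow>\<^sub>E {1..Suc n}" and top: "{b \<in> ?P. f b = Suc n} = J"
        and adm: "admissible ?P f"
        using f unfolding fib_def colourings_def by auto
      have "f b \<in> {1..n}" if "b \<in> ?P - J" for b
        using PiE_mem[OF fP, of b] that top by auto
      then have "?r f \<in> (?P - J) \<rightarrow>\<^sub>E {1..n}" by auto
      moreover have "admissible (?P - J) f"
        using split[OF fP top] adm by simp
      then have "admissible (?P - J) (?r f)"
        using admissible_cong[of "?P - J" f "?r f"] by auto
      ultimately show ?thesis unfolding colourings_def by blast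
    qed
    have "bij_betw ?r (fib J) (colourings (?P - J) n)"
    proof (rule bij_betw_byWitness[where f' = ?e])
      show "\<forall>f\<in>fib J. ?e (?r f) = f"
      proof
        fix f assume f: "f \<in> fib J"
        then have fP: "f \<in> ?P \<rightarrow>\<^sub>E {1..Suc n}" and top: "{b \<in> ?P. f b = Suc n} = J"
          unfolding fib_def colourings_def by auto
        show "?e (?r f) = f"
          using top PiE_arb[OF fP] by (auto simp: fun_eq_iff restrict_def)
      qed
      show "\<forall>g\<in>colourings (?P - J) n. ?r (?e g) = g"
      proof
        fix g assume "g \<in> colourings (?P - J) n"
        then have gP: "g \<in> (?P - J) \<rightarrow>\<^sub>E {1..n}" unfolding colourings_def by auto
        show "?r (?e g) = g"
          using PiE_arb[OF gP] by (auto simp: fun_eq_iff restrict_def)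
      qed
    qed (use e r in blast)+
    then show "card (fib J) = card (colourings (?P - J) n)" by (rule bij_betw_same_card)
  qed
  finally show ?thesis .
qed

lemma rank_less_iff:
  assumes "finite S" "x \<in> S" "y \<in> S"
  shows "rank S x < rank S y \<longleftrightarrow> x < y"
proof -
  have "rank S x < rank S y" if "y \<in> S" "x < y" for x y
  proof -
    have "y \<notin> {z \<in> S. z \<le> x}" "y \<in> {z \<in> S. z \<le> y}"
      and "{z \<in> S. z \<le> x} \<subseteq> {z \<in> S. z \<le> y}" using that by auto
    then have "{z \<in> S. z \<le> x} \<subset> {z \<in> S. z \<le> y}" by blast
    then show ?thesis unfolding rank_def using assms(1) by (intro psubset_card_mono) auto
  qed
  from this[of y x] this[of x y] show ?thesis
    using assms by (metis linorder_neqE_nat order_less_asym)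
qed

text \<open>
  \<^const>\<open>rank\<close> is strictly increasing on \<open>\<Union>Y\<close>, so it respects minima, maxima, nesting and the
  relation between gaps and blocks, which is all that admissibility refers to.
\<close>

lemma renumber_transport:
  assumes Y: "Y \<subseteq> blocks \<pi>"
  shows inj_on_renumber: "inj_on ((`) (rank (\<Union>Y))) Y"
    and admissible_renumber:
      "admissible (renumber Y) h \<longleftrightarrow> admissible Y (\<lambda>b. h (rank (\<Union>Y) ` b))"
proof -
  let ?g = "rank (\<Union>Y)"
  have finU: "finite (\<Union>Y)"
    by (rule finite_subset[OF _ blocks_finite[of \<pi>]]) (use Y in auto)
  have less: "?g x < ?g y \<longleftrightarrow> x < y" if "x \<in> \<Union>Y" "y \<in> \<Union>Y" for x y
    using rank_less_iff[OF finU that] .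
  then have leq: "?g x \<le> ?g y \<longleftrightarrow> x \<le> y" if "x \<in> \<Union>Y" "y \<in> \<Union>Y" for x y
    using that by (meson not_less)
  have inj: "inj_on ?g (\<Union>Y)"
    by (rule inj_onI) (metis less less_irrefl linorder_neqE_nat)
  show injY: "inj_on ((`) ?g) Y"
    by (rule inj_onI) (metis Union_upper inj inj_on_image_eq_iff)
  have fin: "finite b" and ne: "b \<noteq> {}" if "b \<in> Y" for b
    using that Y finite_block block_nonempty by blast+
  have mM: "Min b \<in> b" "Max b \<in> b" if "b \<in> Y" for b
    using fin ne that by simp_all
  have mmU: "Min b \<in> \<Union>Y" "Max b \<in> \<Union>Y" if "b \<in> Y" for b
    using mM that by blast+
  have ends: "?g (Min b) \<le> ?g x" "?g x \<le> ?g (Max b)" if b: "b \<in> Y" and x: "x \<in> b" for b x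
  proof -
    have "x \<in> \<Union>Y" using b x by blast
    then show "?g (Min b) \<le> ?g x" "?g x \<le> ?g (Max b)"
      using leq mmU[OF b] fin[OF b] x by simp_all
  qed
  have Max: "Max (?g ` b) = ?g (Max b)" if b: "b \<in> Y" for b
    by (rule Max_eqI) (use fin[OF b] mM[OF b] ends[OF b] in auto)
  have Min: "Min (?g ` b) = ?g (Min b)" if b: "b \<in> Y" for b
    by (rule Min_eqI) (use fin[OF b] mM[OF b] ends[OF b] in auto)
  have nest: "nest (?g ` b) (?g ` c) \<longleftrightarrow> nest b c" if "b \<in> Y" "c \<in> Y" for b c
  proof -
    have "?g x \<in> {?g (Min b)..?g (Max b)} \<longleftrightarrow> x \<in> {Min b..Max b}" if "x \<in> c" for x
      using leq[of "Min b" x] leq[of x "Max b"] mmU \<open>b \<in> Y\<close> \<open>c \<in> Y\<close> that by auto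
    then show ?thesis
      unfolding nest_def Max[OF \<open>b \<in> Y\<close>] Min[OF \<open>b \<in> Y\<close>] by blast
  qed
  have gap: "{?g (Max b)<..<?g (Min c)} \<inter> ?g ` d \<noteq> {} \<longleftrightarrow> {Max b<..<Min c} \<inter> d \<noteq> {}"
    if "b \<in> Y" "c \<in> Y" "d \<in> Y" for b c d
  proof -
    have "?g x \<in> {?g (Max b)<..<?g (Min c)} \<longleftrightarrow> x \<in> {Max b<..<Min c}" if "x \<in> d" for x
      using less[of "Max b" x] less[of x "Min c"] mmU \<open>b \<in> Y\<close> \<open>c \<in> Y\<close> \<open>d \<in> Y\<close> that by auto
    then show ?thesis by blast
  qed
  have order: "?g (Max b) < ?g (Min c) \<longleftrightarrow> Max b < Min c" if "b \<in> Y" "c \<in> Y" for b c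
    by (rule less) (rule mmU that)+
  show "admissible (renumber Y) h \<longleftrightarrow> admissible Y (\<lambda>b. h (?g ` b))"
    unfolding admissible_def renumber_def ball_simps bex_simps
    by (intro ball_cong refl)
      (simp add: nest Max Min order gap inj_on_eq_iff[OF injY] cong: bex_cong)
qed

lemma card_colourings_renumber:
  assumes Y: "Y \<subseteq> blocks \<pi>"
  shows "card (colourings (renumber Y) n) = card (colourings Y n)"
proof -
  let ?G = "(`) (rank (\<Union>Y))"
  let ?t = "\<lambda>h. \<lambda>b\<in>Y. h (?G b)"
  let ?s = "\<lambda>f. \<lambda>c\<in>?G ` Y. f (inv_into Y ?G c)"
  have inj: "inj_on ?G Y" by (rule inj_on_renumber[OF Y])
  have R: "renumber Y = ?G ` Y" by (simp add: renumber_def)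
  have adm: "admissible (renumber Y) h \<longleftrightarrow> admissible Y (?t h)" for h
    unfolding admissible_renumber[OF Y] by (rule admissible_cong) simp
  have ts: "?t (?s f) = f" if "f \<in> Y \<rightarrow>\<^sub>E {1..n}" for f
    using PiE_arb[OF that] by (auto simp: fun_eq_iff restrict_def inv_into_f_f[OF inj])
  have "bij_betw ?t (colourings (renumber Y) n) (colourings Y n)"
  proof (rule bij_betw_byWitness[where f' = ?s])
    show "\<forall>h\<in>colourings (renumber Y) n. ?s (?t h) = h"
    proof
      fix h assume "h \<in> colourings (renumber Y) n"
      then have "h \<in> (?G ` Y) \<rightarrow>\<^sub>E {1..n}" unfolding colourings_def R by auto
      from PiE_arb[OF this] show "?s (?t h) = h"
        by (auto simp: fun_eq_iff restrict_def inv_into_f_f[OF inj])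
    qed
    show "\<forall>f\<in>colourings Y n. ?t (?s f) = f" using ts unfolding colourings_def by blast
    show "?t ` colourings (renumber Y) n \<subseteq> colourings Y n"
      using adm by (auto simp: colourings_def R)
    show "?s ` colourings Y n \<subseteq> colourings (renumber Y) n"
    proof (rule image_subsetI)
      fix f assume "f \<in> colourings Y n"
      then have f: "f \<in> Y \<rightarrow>\<^sub>E {1..n}" and "admissible Y f" unfolding colourings_def by auto
      then have "admissible (renumber Y) (?s f)" unfolding adm ts[OF f] by simp
      moreover have "?s f \<in> renumber Y \<rightarrow>\<^sub>E {1..n}"
        unfolding R using f inv_into_into[of _ ?G Y] by (auto simp del: inv_into_f_f)
      ultimately show "?s f \<in> colourings (renumber Y) n" unfolding colourings_def by blast
    qed
  qed
  then show ?thesis by (rule bij_betw_same_card)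
qed

section \<open>The polynomial counts colourings\<close>

text \<open>
  The bound \<open>\<le> 1\<close> covers the empty restriction as well: it is the unit of the algebra, with value \<open>1\<close>.
\<close>

lemma morphism_restr_at_one:
  assumes \<phi>: "double_bialgebra_morphism \<phi>" and Y: "Y \<subseteq> blocks \<pi>"
  shows "poly (\<phi> (restr Y)) 1 = (if card Y \<le> 1 then 1 else 0)"
proof (cases "Y = {}")
  case True
  then show ?thesis
    using \<phi> by (simp add: restr_def morphism_one double_bialgebra_morphism_def)
next
  case False
  have "card (renumber Y) = card Y"
    unfolding renumber_def by (rule card_image[OF inj_on_renumber[OF Y]])
  moreover have "card Y \<noteq> 0"
    using False finite_subset[OF Y finite_blocks] by simp
  ultimately show ?thesis
    using False by (auto simp: restr_def morphism_gen_at_one[OF \<phi>] renumber_ncp[OF Y])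
qed

lemma morphism_restr_ideal_at_one:
  assumes \<phi>: "double_bialgebra_morphism \<phi>" and J: "J \<in> ideals \<pi>"
  shows "poly (\<phi> (restr_ideal J)) 1 = (if isolated J then 1 else 0)"
proof -
  have am: "algebra_morphism \<phi>" using \<phi> unfolding double_bialgebra_morphism_def by blast
  have JP: "J \<subseteq> blocks \<pi>" using J unfolding ideals_def by auto
  have fin: "finite (components (\<Union>J))"
    by (rule finite_components, rule finite_subset[OF _ blocks_finite[of \<pi>]]) (use JP in auto)
  have "poly (\<phi> (restr_ideal J)) 1 =
      (\<Prod>I\<in>components (\<Union>J). if card {b \<in> J. b \<subseteq> I} \<le> 1 then 1 else 0)"
    unfolding restr_ideal_def morphism_prod[OF am] poly_prod
    by (rule prod.cong[OF refl], rule morphism_restr_at_one[OF \<phi>]) (use JP in auto)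
  also have "\<dots> = (if isolated J then 1 else 0)"
    using fin unfolding isolated_iff_components[OF J] by (auto intro: prod_zero)
  finally show ?thesis .
qed

text \<open>
  Starting the induction at \<open>n = 0\<close> turns the counit of \<open>\<Delta>\<close> into the base case: \<open>\<phi>(\<pi>)(0) = 0\<close>, and a
  nonempty set of blocks has no colouring without colours.
\<close>

lemma morphism_gen_counts_colourings:
  assumes \<phi>: "double_bialgebra_morphism \<phi>"
  shows "poly (\<phi> (gen \<pi>)) (of_nat n) = of_nat (card (colourings (blocks \<pi>) n))"
proof (induction n arbitrary: \<pi>)
  case 0
  have "colourings (blocks \<pi>) 0 = {}"
    using blocks_nonempty[of \<pi>] by (auto simp: colourings_def PiE_eq_empty_iff)
  then show ?case by (simp add: morphism_gen_at_zero[OF \<phi>])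
next
  case (Suc n)
  have am: "algebra_morphism \<phi>" using \<phi> unfolding double_bialgebra_morphism_def by blast
  have restr: "poly (\<phi> (restr Y)) (of_nat n) = of_nat (card (colourings Y n))"
    if Y: "Y \<subseteq> blocks \<pi>" for Y
  proof (cases "Y = {}")
    case True
    then show ?thesis
      by (simp add: restr_def morphism_one[OF am] colourings_def admissible_def)
  next
    case False
    then show ?thesis
      using Suc.IH[of "Abs_ncp (renumber Y)"]
      by (simp add: restr_def renumber_ncp[OF Y] card_colourings_renumber[OF Y])
  qed
  have fin: "finite (ideals \<pi>)"
    by (rule finite_subset[of _ "Pow (blocks \<pi>)"]) (auto simp: ideals_def finite_blocks)
  have "poly (\<phi> (gen \<pi>)) (of_nat (Suc n)) = (\<Sum>J\<in>ideals \<pi>.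
      poly (\<phi> (restr (blocks \<pi> - J))) (of_nat n) * poly (\<phi> (restr_ideal J)) 1)"
    using morphism_gen_at_sum[OF \<phi>, of \<pi> "of_nat n" 1] by (simp add: add.commute)
  also have "\<dots> = (\<Sum>J\<in>ideals \<pi>.
      if isolated J then of_nat (card (colourings (blocks \<pi> - J) n)) else 0)"
    by (rule sum.cong[OF refl]) (simp add: restr morphism_restr_ideal_at_one[OF \<phi>])
  also have "\<dots> = of_nat (card (colourings (blocks \<pi>) (Suc n)))"
    unfolding card_colourings_Suc using fin
    by (simp add: sum.If_cases Int_def)
  finally show ?case .
qed

theorem proposition3p1:
  fixes \<phi> :: "'k::field_char_0 ncp_alg \<Rightarrow> 'k poly"
    and \<pi> :: ncp and n :: nat
  assumes "double_bialgebra_morphism \<phi>" and "n \<ge> 1"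
  shows "poly (\<phi> (gen \<pi>)) (of_nat n) = of_nat (card {f \<in> blocks \<pi> \<rightarrow>\<^sub>E {1..n}.
      \<forall>b\<in>blocks \<pi>. \<forall>b'\<in>blocks \<pi>.
        (nest b b' \<and> b \<noteq> b' \<longrightarrow> f b < f b') \<and>
        (f b = f b' \<and> Max b < Min b' \<longrightarrow>
          (\<exists>b''\<in>blocks \<pi>. {Max b<..<Min b'} \<inter> b'' \<noteq> {} \<and> f b'' < f b))})"
  using morphism_gen_counts_colourings[OF assms(1), of \<pi> n]
  unfolding colourings_def admissible_def .

end
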